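(* Let $(\mathfrak X,d,[\cdot,\cdot])$ be a complete and convexifiable CC space. Then there exist a Banach space $(\mathbb E,\|\cdot\|)$ and a map $j:\mathfrak X\to\mathbb E$, with image $j(\mathfrak X)=\mathbb F\subset\mathbb E$, such that: (i) $\mathbb F$ is closed and convex; (ii) $j([\lambda,x;1-\lambda,y])=\lambda j(x)+(1-\lambda)j(y)$ for every $x,y\in\mathfrak X$ and $\lambda\in[0,1]$; (iii) $d(x,y)=\|j(x)-j(y)\|$ for all $x,y\in\mathfrak X$. Furthermore, if $\mathfrak X$ is separable then $\mathbb E$ is also separable.
   Context: A convex combination space (CC space) is a metric space $(\mathfrak X,d)$ endowed with a convex combination operation, which to all $n\ge1$, all $\lambda_1,\dots,\lambda_n>0$ with $\sum_{i=1}^n\lambda_i=1$ and all $u_1,\dots,u_n\in\mathfrak X$ assigns an element $[\lambda_1,u_1;\dots;\lambda_n,u_n]=[\lambda_i,u_i]_{i=1}^n$ of $\mathfrak X$, with $[1,u]=u$, and such that: (CC.i) $[\lambda_i,u_i]_{i=1}^n=[\lambda_{\sigma(i)},u_{\sigma(i)}]_{i=1}^n$ for every permutation $\sigma$ of $\{1,\dots,n\}$; (CC.ii) $[\lambda_i,u_i]_{i=1}^{n+2}=\big[\lambda_1,u_1;\dots;\lambda_n,u_n;\lambda_{n+1}+\lambda_{n+2},\big[\tfrac{\lambda_{n+j}}{\lambda_{n+1}+\lambda_{n+2}},u_{n+j}\big]_{j=1}^2\big]$; (CC.iii) if $u,v\in\mathfrak X$ and $\lambda^{(k)}\to\lambda\in(0,1)$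 then $[\lambda^{(k)},u;1-\lambda^{(k)},v]\to[\lambda,u;1-\lambda,v]$; (CC.iv) for $u_1,u_2,v_1,v_2\in\mathfrak X$ and $\lambda\in(0,1)$, $d([\lambda,u_1;1-\lambda,u_2],[\lambda,v_1;1-\lambda,v_2])\le\lambda d(u_1,v_1)+(1-\lambda)d(u_2,v_2)$; (CC.v) for each $u\in\mathfrak X$ the limit $Ku=K_{\mathfrak X}u:=\lim_{n\to\infty}[n^{-1},u]_{i=1}^n$ exists in $\mathfrak X$; $K$ is called the convexification operator. Write $K(\mathfrak X)=\{Ku:u\in\mathfrak X\}$. The operator $K$ is idempotent, so $K(\mathfrak X)=\{u: Ku=u\}$. The space $\mathfrak X$ is convexifiable if $K(\mathfrak X)=\mathfrak X$. For points of $K(\mathfrak X)$, weights are allowed in $[0,1]$ by discarding the entries with weight $0$ (so $[1,x;0,y]=x$). *)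

theory Defs
  imports "HOL-Analysis.Analysis" "HOL-Combinatorics.Permutations"
begin

section \<open>Convex combination spaces\<close>

text \<open>
  The element \<open>[\<lambda>\<^sub>1,u\<^sub>1; \<dots>; \<lambda>\<^sub>n,u\<^sub>n]\<close> is written \<open>cc [(\<lambda>\<^sub>1,u\<^sub>1), \<dots>, (\<lambda>\<^sub>n,u\<^sub>n)]\<close>.
  Only lists satisfying \<open>convex_weights\<close> are meaningful arguments of \<open>cc\<close>; nothing is
  assumed about its values elsewhere. The condition \<open>n \<ge> 1\<close> follows from the weights having
  sum \<open>1\<close>.
\<close>

definition convex_weights :: "(real \<times> 'a) list \<Rightarrow> bool" where
  "convex_weights xs \<longleftrightarrow> (\<forall>p\<in>set xs. 0 < fst p) \<and> sum_list (map fst xs) = 1"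

definition uniform_comb :: "((real \<times> 'a) list \<Rightarrow> 'a) \<Rightarrow> 'a \<Rightarrow> nat \<Rightarrow> 'a" where
  "uniform_comb cc u n = cc (replicate n (1 / real n, u))"

text \<open>In \<open>uniform_comb\<close> the term for \<open>n = 0\<close> is meaningless, but irrelevant for limits.\<close>

locale CC_space =
  fixes cc :: "(real \<times> 'a::metric_space) list \<Rightarrow> 'a"
  assumes cc_single: "cc [(1, u)] = u"
    and cc_perm: "convex_weights xs \<Longrightarrow> \<sigma> permutes {..<length xs} \<Longrightarrow>
          cc xs = cc (permute_list \<sigma> xs)"
    and cc_assoc: "convex_weights (xs @ [(a, u), (b, v)]) \<Longrightarrow>
          cc (xs @ [(a, u), (b, v)]) =
          cc (xs @ [(a + b, cc [(a / (a + b), u), (b / (a + b), v)])])"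
    and cc_cont: "(\<forall>k. 0 < l k \<and> l k < 1) \<Longrightarrow> 0 < m \<Longrightarrow> m < 1 \<Longrightarrow> l \<longlonglongrightarrow> m \<Longrightarrow>
          (\<lambda>k. cc [(l k, u), (1 - l k, v)]) \<longlonglongrightarrow> cc [(m, u), (1 - m, v)]"
    and cc_dist: "0 < m \<Longrightarrow> m < 1 \<Longrightarrow>
          dist (cc [(m, u1), (1 - m, u2)]) (cc [(m, v1), (1 - m, v2)])
          \<le> m * dist u1 v1 + (1 - m) * dist u2 v2"
    and cc_convergent: "convergent (uniform_comb cc u)"

definition convexification :: "((real \<times> 'a::metric_space) list \<Rightarrow> 'a) \<Rightarrow> 'a \<Rightarrow> 'a" where
  "convexification cc u = lim (uniform_comb cc u)"

definition convexifiable :: "((real \<times> 'a::metric_space) list \<Rightarrow> 'a) \<Rightarrow> bool" where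
  "convexifiable cc \<longleftrightarrow> range (convexification cc) = UNIV"

text \<open>Extension of the operation to weights in \<open>[0,1]\<close>: entries of weight \<open>0\<close> are discarded.\<close>

definition cc_ext :: "((real \<times> 'a) list \<Rightarrow> 'a) \<Rightarrow> (real \<times> 'a) list \<Rightarrow> 'a" where
  "cc_ext cc xs = cc (filter (\<lambda>p. fst p \<noteq> 0) xs)"


section \<open>Real Banach spaces on a carrier set\<close>

text \<open>
  A type cannot be quantified existentially, so a Banach space whose existence is claimed is
  given by a carrier set together with its operations and its norm. Nothing is assumed about
  the operations outside the carrier.
\<close>

locale normed_space_on =
  fixes E :: "'e set"
    and add :: "'e \<Rightarrow> 'e \<Rightarrow> 'e"
    and zero :: 'e
    and scale :: "real \<Rightarrow> 'e \<Rightarrow> 'e"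
    and nrm :: "'e \<Rightarrow> real"
  assumes add_closed: "x \<in> E \<Longrightarrow> y \<in> E \<Longrightarrow> add x y \<in> E"
    and zero_closed: "zero \<in> E"
    and scale_closed: "x \<in> E \<Longrightarrow> scale a x \<in> E"
    and add_assoc: "x \<in> E \<Longrightarrow> y \<in> E \<Longrightarrow> z \<in> E \<Longrightarrow> add (add x y) z = add x (add y z)"
    and add_commute: "x \<in> E \<Longrightarrow> y \<in> E \<Longrightarrow> add x y = add y x"
    and add_zero: "x \<in> E \<Longrightarrow> add x zero = x"
    and add_inverse: "x \<in> E \<Longrightarrow> \<exists>y\<in>E. add x y = zero"
    and scale_one: "x \<in> E \<Longrightarrow> scale 1 x = x"
    and scale_scale: "x \<in> E \<Longrightarrow> scale a (scale b x) = scale (a * b) x"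
    and scale_add_left: "x \<in> E \<Longrightarrow> scale (a + b) x = add (scale a x) (scale b x)"
    and scale_add_right: "x \<in> E \<Longrightarrow> y \<in> E \<Longrightarrow> scale a (add x y) = add (scale a x) (scale a y)"
    and nrm_nonneg: "x \<in> E \<Longrightarrow> 0 \<le> nrm x"
    and nrm_eq_zero: "x \<in> E \<Longrightarrow> nrm x = 0 \<longleftrightarrow> x = zero"
    and nrm_scale: "x \<in> E \<Longrightarrow> nrm (scale a x) = \<bar>a\<bar> * nrm x"
    and nrm_triangle: "x \<in> E \<Longrightarrow> y \<in> E \<Longrightarrow> nrm (add x y) \<le> nrm x + nrm y"
begin

definition sub :: "'e \<Rightarrow> 'e \<Rightarrow> 'e" where
  "sub x y = add x (scale (- 1) y)"

text \<open>
  The locale \<open>Metric_space\<close> requires non-negativity and symmetry also off the carrier, hence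
  the value \<open>0\<close> there.
\<close>

definition ndist :: "'e \<Rightarrow> 'e \<Rightarrow> real" where
  "ndist x y = (if x \<in> E \<and> y \<in> E then nrm (sub x y) else 0)"

definition convex_in :: "'e set \<Rightarrow> bool" where
  "convex_in F \<longleftrightarrow> F \<subseteq> E \<and>
    (\<forall>x\<in>F. \<forall>y\<in>F. \<forall>t\<in>{0..1}. add (scale t x) (scale (1 - t) y) \<in> F)"

lemma scale_zero_left:
  assumes x: "x \<in> E" shows "scale 0 x = zero"
proof -
  let ?z = "scale 0 x"
  have z: "?z \<in> E" using x by (rule scale_closed)
  obtain w where w: "w \<in> E" "add ?z w = zero" using add_inverse[OF z] by blast
  have "add ?z ?z = ?z" using scale_add_left[OF x, of 0 0] by simp
  then have "add (add ?z ?z) w = zero" using w by simp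
  then have "add ?z zero = zero" using add_assoc[OF z z w(1)] w by simp
  then show ?thesis using add_zero[OF z] by simp
qed

lemma add_minus:
  assumes x: "x \<in> E" shows "add (scale (- 1) x) x = zero"
  using scale_add_left[OF x, of "- 1" 1] scale_one[OF x] scale_zero_left[OF x] by simp

lemma sub_closed: "x \<in> E \<Longrightarrow> y \<in> E \<Longrightarrow> sub x y \<in> E"
  by (simp add: sub_def add_closed scale_closed)

lemma sub_add_sub:
  assumes "x \<in> E" "y \<in> E" "z \<in> E" shows "add (sub x y) (sub y z) = sub x z"
proof -
  let ?my = "scale (- 1) y" and ?mz = "scale (- 1) z"
  have m: "?my \<in> E" "?mz \<in> E" using assms by (auto intro: scale_closed)
  have "add (sub x y) (sub y z) = add x (add (add ?my y) ?mz)"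
    using assms m by (simp add: sub_def add_assoc add_closed)
  also have "add (add ?my y) ?mz = ?mz"
    using m assms add_minus add_commute add_zero zero_closed by metis
  finally show ?thesis by (simp add: sub_def)
qed

lemma sub_swap:
  assumes "x \<in> E" "y \<in> E" shows "sub y x = scale (- 1) (sub x y)"
  using assms
  by (simp add: sub_def scale_add_right scale_closed scale_scale scale_one add_commute)

lemma sub_eq_zero:
  assumes "x \<in> E" "y \<in> E" shows "sub x y = zero \<longleftrightarrow> x = y"
proof
  assume "sub x y = zero"
  then have "add (add x (scale (- 1) y)) y = add zero y" by (simp add: sub_def)
  then show "x = y"
    using assms by (metis add_assoc add_commute add_minus add_zero scale_closed zero_closed)
next
  assume "x = y"
  then show "sub x y = zero"
    using assms by (metis add_commute add_minus scale_closed sub_def)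
qed

sublocale Metric_space E ndist
proof
  show "0 \<le> ndist x y" for x y by (simp add: ndist_def nrm_nonneg sub_closed)
  show "ndist x y = ndist y x" for x y
    using nrm_scale[OF sub_closed, of x y "- 1"] sub_swap[of x y] by (simp add: ndist_def)
  show "ndist x y = 0 \<longleftrightarrow> x = y" if "x \<in> E" "y \<in> E" for x y
    using that by (simp add: ndist_def nrm_eq_zero sub_closed sub_eq_zero)
  show "ndist x z \<le> ndist x y + ndist y z" if "x \<in> E" "y \<in> E" "z \<in> E" for x y z
    using that nrm_triangle[of "sub x y" "sub y z"]
    by (simp add: ndist_def sub_closed sub_add_sub)
qed

end

locale banach_space_on = normed_space_on +
  assumes complete: "mcomplete"

end

theory Submission
  imports Defs "HOL-Probability.Discrete_Topology"
begin

text \<open>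
  In a convexifiable space \<open>[\<lambda>,u; 1 - \<lambda>,u] = u\<close>, and combinations of two points satisfy a medial
  law. Affine functions of Lipschitz constant at most \<open>1\<close> then separate points as well as the
  metric does: a minimal convex such function below \<open>dist _ y\<close> with its value \<open>dist x y\<close> at \<open>x\<close>
  prescribed is affine, since its tangents are competitors below it. This replaces the
  Hahn-Banach theorem, no vector space being available yet. Evaluation on these affine functions
  embeds the space isometrically and affinely into bounded functions, and \<open>E\<close> is the closed
  linear span of the image.
\<close>

section \<open>Affine functions on a convex metric space\<close>

text \<open>Both sides of \<open>m_medial\<close> stand for the combination of \<open>u\<close>,
  \<open>v\<close>, \<open>w\<close>, \<open>z\<close> with weights \<open>a\<close>,
  \<open>b\<close>, \<open>c\<close>, \<open>d\<close>, its four entries paired in two ways.\<close>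

locale convex_metric =
  fixes m :: "real \<Rightarrow> 'a::metric_space \<Rightarrow> 'a \<Rightarrow> 'a"
  assumes m_idem: "0 < t \<Longrightarrow> t < 1 \<Longrightarrow> m t x x = x"
    and m_commute: "0 < t \<Longrightarrow> t < 1 \<Longrightarrow> m t x y = m (1 - t) y x"
    and m_medial: "0 < a \<Longrightarrow> 0 < b \<Longrightarrow> 0 < c \<Longrightarrow> 0 < d \<Longrightarrow> a + b + c + d = 1 \<Longrightarrow>
      m (a + b) (m (a / (a + b)) u v) (m (c / (c + d)) w z)
      = m (a + c) (m (a / (a + c)) u w) (m (b / (b + d)) v z)"
    and m_dist: "0 < t \<Longrightarrow> t < 1 \<Longrightarrow>
      dist (m t u1 u2) (m t v1 v2) \<le> t * dist u1 v1 + (1 - t) * dist u2 v2"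
begin

section \<open>Convex, affine and short functions\<close>

definition convex_fun :: "('a \<Rightarrow> real) \<Rightarrow> bool" where
  "convex_fun p \<longleftrightarrow> (\<forall>u v. \<forall>t\<in>{0<..<1}. p (m t u v) \<le> t * p u + (1 - t) * p v)"

definition affine_fun :: "('a \<Rightarrow> real) \<Rightarrow> bool" where
  "affine_fun p \<longleftrightarrow> (\<forall>u v. \<forall>t\<in>{0<..<1}. p (m t u v) = t * p u + (1 - t) * p v)"

definition short_fun :: "('a \<Rightarrow> real) \<Rightarrow> bool" where
  "short_fun p \<longleftrightarrow> (\<forall>u v. p u - p v \<le> dist u v)"

lemma convex_funD: "convex_fun p \<Longrightarrow> 0 < t \<Longrightarrow> t < 1 \<Longrightarrow> p (m t u v) \<le> t * p u + (1 - t) * p v"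
  by (simp add: convex_fun_def)

lemma affine_funD: "affine_fun p \<Longrightarrow> 0 < t \<Longrightarrow> t < 1 \<Longrightarrow> p (m t u v) = t * p u + (1 - t) * p v"
  by (simp add: affine_fun_def)

lemma short_funD: "short_fun p \<Longrightarrow> p u - p v \<le> dist u v"
  by (simp add: short_fun_def)

lemma convex_fun_dist: "convex_fun (\<lambda>u. dist u y)"
  unfolding convex_fun_def
proof (intro allI ballI)
  fix u v and t :: real assume "t \<in> {0<..<1}"
  then show "dist (m t u v) y \<le> t * dist u y + (1 - t) * dist v y"
    using m_dist[of t u v y y] m_idem[of t y] by simp
qed

lemma short_fun_dist: "short_fun (\<lambda>u. dist u y)"
  unfolding short_fun_def by (metis diff_le_eq dist_triangle add.commute)

section \<open>Tangents of a short function\<close>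

definition diffquot :: "('a \<Rightarrow> real) \<Rightarrow> 'a \<Rightarrow> 'a \<Rightarrow> real \<Rightarrow> real" where
  "diffquot p v w s = (p (m s w v) - (1 - s) * p v) / s"

text \<open>\<open>diffquot p v w s\<close> is the value at \<open>w\<close> of the line through the
  graph of \<open>p\<close> over \<open>v\<close> and \<open>m s w v\<close>. For a convex function
  on a vector space these values decrease as \<open>s\<close> tends to 0, so the infimum is
  \<open>p v\<close> plus the directional derivative at \<open>v\<close> towards
  \<open>w\<close>.\<close>

definition tangent :: "('a \<Rightarrow> real) \<Rightarrow> 'a \<Rightarrow> 'a \<Rightarrow> real" where
  "tangent p v w = (INF s\<in>{0<..<1}. diffquot p v w s)"

context
  fixes p :: "'a \<Rightarrow> real"
  assumes short: "short_fun p"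
begin

text \<open>As \<open>v = m s v v\<close>, the point \<open>m s w v\<close> lies within
  \<open>s * dist w v\<close> of \<open>v\<close>. The bound keeps the infimum in
  \<open>tangent\<close> finite.\<close>

lemma diffquot_ge:
  assumes "0 < s" "s < 1"
  shows "p v - dist w v \<le> diffquot p v w s"
proof -
  have "p v - p (m s w v) \<le> s * dist w v"
    using short_funD[OF short, of v "m s w v"] m_dist[of s v v w v] m_idem[of s v] assms
    by (simp add: dist_commute)
  then show ?thesis using assms by (simp add: diffquot_def field_simps)
qed

lemma bdd_below_diffquot: "bdd_below (diffquot p v w ` {0<..<1})"
  by (rule bdd_belowI2[where m = "p v - dist w v"]) (simp add: diffquot_ge)

lemma tangent_le_diffquot: "0 < s \<Longrightarrow> s < 1 \<Longrightarrow> tangent p v w \<le> diffquot p v w s"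
  unfolding tangent_def by (rule cINF_lower[OF bdd_below_diffquot]) simp

lemma tangent_approx:
  assumes "0 < e" obtains s where "0 < s" "s < 1" "diffquot p v w s < tangent p v w + e"
proof -
  have "\<exists>s\<in>{0<..<1::real}. diffquot p v w s < tangent p v w + e"
    using cINF_less_iff[OF _ bdd_below_diffquot[of v w], of "tangent p v w + e"] assms
    by (simp add: tangent_def)
  then show ?thesis using that by auto
qed

text \<open>Replacing \<open>w\<close> by \<open>u\<close> moves \<open>m s w v\<close> by at most
  \<open>s * dist u w\<close>, and the division by \<open>s\<close> cancels the factor.\<close>

lemma short_fun_tangent: "short_fun (tangent p v)"
  unfolding short_fun_def
proof (intro allI)
  fix u w
  show "tangent p v u - tangent p v w \<le> dist u w"
  proof (rule field_le_epsilon)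
    fix e :: real assume "0 < e"
    then obtain s where s: "0 < s" "s < 1" "diffquot p v w s < tangent p v w + e"
      by (rule tangent_approx)
    have "p (m s u v) - p (m s w v) \<le> s * dist u w"
      using short_funD[OF short, of "m s u v" "m s w v"] m_dist[of s u v w v] s by simp
    then have "diffquot p v u s \<le> (p (m s w v) + s * dist u w - (1 - s) * p v) / s"
      unfolding diffquot_def using s by (intro divide_right_mono) auto
    also have "\<dots> = diffquot p v w s + dist u w"
      using s by (simp add: diffquot_def field_simps)
    finally have "diffquot p v u s \<le> diffquot p v w s + dist u w" .
    then show "tangent p v u - tangent p v w \<le> dist u w + e"
      using tangent_le_diffquot[of s v u] s by linarith
  qed
qed

text \<open>Near-optimal parameters \<open>r\<close> for \<open>u\<close> and \<open>q\<close> for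
  \<open>w\<close> are merged: for suitable \<open>s\<close> and \<open>k\<close> the medial law
  gives \<open>m s (m t u w) v = m k (m r u v) (m q w v)\<close>, and convexity of \<open>p\<close>
  applies to the right-hand side.\<close>

lemma convex_fun_tangent:
  assumes "convex_fun p" shows "convex_fun (tangent p v)"
  unfolding convex_fun_def
proof (intro allI ballI)
  fix u w and t :: real assume "t \<in> {0<..<1}"
  then have t: "0 < t" "t < 1" by auto
  show "tangent p v (m t u w) \<le> t * tangent p v u + (1 - t) * tangent p v w"
  proof (rule field_le_epsilon)
    fix e :: real assume e: "0 < e"
    obtain r where r: "0 < r" "r < 1" "diffquot p v u r < tangent p v u + e"
      using e by (rule tangent_approx)
    obtain q where q: "0 < q" "q < 1" "diffquot p v w q < tangent p v w + e"
      using e by (rule tangent_approx)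
    \<comment> \<open>Equal weights of \<open>u\<close> and of \<open>w\<close> on both sides
      require \<open>t * s = k * r\<close> and \<open>(1 - t) * s = (1 - k) * q\<close>. Eliminating
      \<open>k\<close> makes \<open>s\<close> the weighted harmonic mean of \<open>r\<close> and
      \<open>q\<close>, below 1 since both are.\<close>
    define s where "s = 1 / (t / r + (1 - t) / q)"
    have pos: "0 < t / r" "0 < (1 - t) / q" using t r q by auto
    have s0: "0 < s" using pos by (simp add: s_def)
    have "t * r < t * 1" "(1 - t) * q < (1 - t) * 1"
      using t r q by (auto intro!: mult_strict_left_mono simp del: mult_1_right)
    then have "t < t / r" "1 - t < (1 - t) / q"
      using r q by (simp_all only: pos_less_divide_eq mult_1_right)
    then have "t / r + (1 - t) / q > 1" by linarith
    then have s1: "s < 1" by (simp add: s_def)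
    have sum: "t * s / r + (1 - t) * s / q = 1"
    proof -
      have "s * (t / r + (1 - t) / q) = 1" using pos by (simp add: s_def)
      then show ?thesis by (simp add: algebra_simps)
    qed
    define k where "k = t * s / r"
    have k1: "1 - k = (1 - t) * s / q" using sum by (simp add: k_def)
    have "0 < k" "0 < (1 - t) * s / q" using t s0 r q by (auto simp: k_def)
    then have k: "0 < k" "k < 1" using k1 by linarith+
    \<comment> \<open>Weights of the four-point combination: \<open>a\<close> on \<open>u\<close>,
      \<open>b\<close> on \<open>w\<close>, while \<open>c\<close> and \<open>d\<close> are the two
      shares of \<open>v\<close>.\<close>
    define a b c d where "a = t * s" and "b = (1 - t) * s"
      and "c = k * (1 - r)" and "d = (1 - k) * (1 - q)"
    have kr: "k * r = t * s" and kq: "(1 - k) * q = (1 - t) * s"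
      using r q k1 by (auto simp: k_def)
    have ab: "a + b = s" by (simp add: a_def b_def algebra_simps)
    have ac: "a + c = k" using kr by (simp add: a_def c_def algebra_simps)
    have bd: "b + d = 1 - k" using kq by (simp add: b_def d_def algebra_simps)
    have P: "0 < a" "0 < b" "0 < c" "0 < d" using t s0 k r q by (auto simp: a_def b_def c_def d_def)
    have cd: "c + d = 1 - s" using ab ac bd by linarith
    have "a / s = t" using s0 by (simp add: a_def)
    moreover have "a / k = r" using k by (simp add: a_def kr[symmetric])
    moreover have "b / (1 - k) = q" using k by (simp add: b_def kq[symmetric])
    ultimately have q1: "a / (a + b) = t" "a / (a + c) = r" "b / (b + d) = q"
      unfolding ab ac bd by auto
    have v: "m (c / (c + d)) v v = v" using P by (intro m_idem) (simp_all add: add_pos_pos)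
    have "m s (m t u w) v = m k (m r u v) (m q w v)"
      using m_medial[OF P, of u w v v] ab cd v q1 ac by simp
    then have "p (m s (m t u w) v) \<le> k * p (m r u v) + (1 - k) * p (m q w v)"
      using convex_funD[OF assms k, of "m r u v" "m q w v"] by simp
    also have "\<dots> = k * r * diffquot p v u r + (1 - k) * q * diffquot p v w q
        + (k * (1 - r) + (1 - k) * (1 - q)) * p v"
      using r q by (simp add: diffquot_def field_simps)
    also have "\<dots> = s * (t * diffquot p v u r + (1 - t) * diffquot p v w q) + (1 - s) * p v"
      unfolding kr kq cd[unfolded c_def d_def] by (simp add: algebra_simps)
    finally have "diffquot p v (m t u w) s \<le> t * diffquot p v u r + (1 - t) * diffquot p v w q"
      unfolding diffquot_def[of p v "m t u w" s] pos_divide_le_eq[OF s0]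
      by (simp add: mult.commute)
    moreover have "t * diffquot p v u r + (1 - t) * diffquot p v w q
        \<le> t * (tangent p v u + e) + (1 - t) * (tangent p v w + e)"
      using less_imp_le[OF r(3)] less_imp_le[OF q(3)] t by (intro add_mono mult_left_mono) simp_all
    ultimately show "tangent p v (m t u w) \<le> t * tangent p v u + (1 - t) * tangent p v w + e"
      using tangent_le_diffquot[OF s0 s1, of v "m t u w"] by (simp add: algebra_simps)
  qed
qed

lemma tangent_le:
  assumes "convex_fun p" shows "tangent p v \<le> p"
proof (rule le_funI)
  fix w
  have "diffquot p v w (1/2) \<le> p w"
    using convex_funD[OF assms, of "1/2" w v] by (simp add: diffquot_def)
  then show "tangent p v w \<le> p w" using tangent_le_diffquot[of "1/2" v w] by simp
qed

lemma tangent_self: "tangent p v v = p v"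
proof -
  have "diffquot p v v s = p v" if "s \<in> {0<..<1}" for s
    using that m_idem[of s v] by (simp add: diffquot_def field_simps)
  then show ?thesis by (simp add: tangent_def)
qed

end

section \<open>Minimal convex functions with a prescribed value\<close>

definition admissible :: "'a \<Rightarrow> real \<Rightarrow> ('a \<Rightarrow> real) set" where
  "admissible x D = {p. convex_fun p \<and> short_fun p \<and> p x = D}"

text \<open>The pointwise infimum works: the common value \<open>D\<close> at \<open>x\<close> and
  shortness bound the members below by \<open>D - dist x w\<close>. Infima of convex functions need
  not be convex, but in a chain the smaller of two members is nearly optimal at both
  \<open>u\<close> and \<open>v\<close>.\<close>

lemma Inf_chain_admissible:
  assumes "C \<noteq> {}" "C \<subseteq> admissible x D" "\<And>p q. p \<in> C \<Longrightarrow> q \<in> C \<Longrightarrow> p \<le> q \<or> q \<le> p"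
  obtains q where "q \<in> admissible x D" "\<And>p. p \<in> C \<Longrightarrow> q \<le> p"
proof
  have adm: "convex_fun p" "short_fun p" "p x = D" if "p \<in> C" for p
    using that assms(2) by (auto simp: admissible_def)
  let ?q = "\<lambda>w. INF p\<in>C. p w"
  have bdd: "bdd_below ((\<lambda>p. p w) ` C)" for w
    using short_funD[OF adm(2), of _ x w] adm(3)
    by (intro bdd_belowI2[where m = "D - dist x w"]) (auto simp: algebra_simps)
  have le: "?q w \<le> p w" if "p \<in> C" for p w
    using that by (rule cINF_lower[OF bdd])
  have approx: "\<exists>p\<in>C. p w < ?q w + e" if "0 < e" for w e
    using cINF_less_iff[OF assms(1) bdd, of w "?q w + e"] that by simp
  show "?q \<le> p" if "p \<in> C" for p by (rule le_funI) (rule le[OF that])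
  have "convex_fun ?q" unfolding convex_fun_def
  proof (intro allI ballI)
    fix u v and t :: real assume t: "t \<in> {0<..<1}"
    show "?q (m t u v) \<le> t * ?q u + (1 - t) * ?q v"
    proof (rule field_le_epsilon)
      fix e :: real assume "0 < e"
      then obtain p1 p2 where p: "p1 \<in> C" "p1 u < ?q u + e" "p2 \<in> C" "p2 v < ?q v + e"
        using approx by metis
      obtain p where p': "p \<in> C" "p u \<le> p1 u" "p v \<le> p2 v"
        using assms(3)[OF p(1,3)] p(1,3) by (auto simp: le_fun_def)
      have "?q (m t u v) \<le> t * p u + (1 - t) * p v"
        using le[OF p'(1), of "m t u v"] convex_funD[OF adm(1)[OF p'(1)], of t u v] t by simp
      also have "\<dots> \<le> t * (?q u + e) + (1 - t) * (?q v + e)"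
        using t p p' by (intro add_mono mult_left_mono) auto
      finally show "?q (m t u v) \<le> t * ?q u + (1 - t) * ?q v + e" by (simp add: algebra_simps)
    qed
  qed
  moreover have "short_fun ?q" unfolding short_fun_def
  proof (intro allI)
    fix u v
    show "?q u - ?q v \<le> dist u v"
    proof (rule field_le_epsilon)
      fix e :: real assume "0 < e"
      then obtain p where p: "p \<in> C" "p v < ?q v + e" using approx by metis
      show "?q u - ?q v \<le> dist u v + e"
        using le[OF p(1), of u] p(2) short_funD[OF adm(2)[OF p(1)], of u v] by linarith
    qed
  qed
  moreover have "?q x = D"
  proof -
    have "(\<lambda>p. p x) ` C = {D}" using assms(1) adm(3) by force
    then show ?thesis by simp
  qed
  ultimately show "?q \<in> admissible x D" by (simp add: admissible_def)
qed

text \<open>Zorn's lemma for the reversed order, applied to the functions below \<open>p0\<close>.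
  The element found is minimal among all admissible functions, since anything below it is also below
  \<open>p0\<close>.\<close>

lemma minimal_admissible:
  assumes "p0 \<in> admissible x D"
  obtains p where "p \<in> admissible x D" "p \<le> p0"
    "\<And>q. q \<in> admissible x D \<Longrightarrow> q \<le> p \<Longrightarrow> q = p"
proof -
  let ?A = "{p \<in> admissible x D. p \<le> p0}"
  have "\<exists>p\<in>?A. \<forall>q\<in>?A. q \<le> p \<longrightarrow> q = p"
  proof (rule predicate_Zorn[where P = "\<lambda>p q. q \<le> p"])
    show "partial_order_on ?A (relation_of (\<lambda>p q. q \<le> p) ?A)"
      by (rule partial_order_on_relation_ofI) auto
    fix C assume "C \<in> Chains (relation_of (\<lambda>p q. q \<le> p) ?A)"
    then have C: "C \<subseteq> ?A" "\<And>p q. p \<in> C \<Longrightarrow> q \<in> C \<Longrightarrow> p \<le> q \<or> q \<le> p"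
      by (auto simp: Chains_def relation_of_def)
    show "\<exists>u\<in>?A. \<forall>a\<in>C. u \<le> a"
    proof (cases "C = {}")
      case True then show ?thesis using assms by auto
    next
      case False
      have "C \<subseteq> admissible x D" using C(1) by blast
      then obtain q where q: "q \<in> admissible x D" "\<And>p. p \<in> C \<Longrightarrow> q \<le> p"
        using Inf_chain_admissible[OF False _ C(2)] by blast
      obtain p where "p \<in> C" "p \<le> p0" using False C(1) by blast
      then have "q \<le> p0" using q(2) order_trans by blast
      then show ?thesis using q by blast
    qed
  qed
  then obtain p where p: "p \<in> admissible x D" "p \<le> p0" "\<forall>q\<in>?A. q \<le> p \<longrightarrow> q = p" by blast
  show ?thesis
  proof
    show "q = p" if "q \<in> admissible x D" "q \<le> p" for q
      using p(2,3) that order_trans[OF that(2) p(2)] by blast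
  qed (fact p)+
qed

text \<open>
  Minimality first at the base point \<open>x\<close> makes \<open>p\<close> affine along segments from \<open>x\<close>; this makes
  every tangent of \<open>p\<close> take the value \<open>D\<close> at \<open>x\<close>, so minimality applies to all of them.
\<close>

lemma minimal_admissible_affine:
  assumes "p \<in> admissible x D" and min: "\<And>q. q \<in> admissible x D \<Longrightarrow> q \<le> p \<Longrightarrow> q = p"
  shows "affine_fun p"
proof -
  have p: "convex_fun p" "short_fun p" "p x = D" using assms(1) by (auto simp: admissible_def)
  have aff: "p (m t u v) = t * p u + (1 - t) * p v"
    if v: "tangent p v x = D" and t: "0 < t" "t < 1" for u v t
  proof (rule antisym)
    \<comment> \<open>The tangent is an admissible function below \<open>p\<close>, hence equal to
      \<open>p\<close>. Then \<open>p u\<close> is at most each of its own quotients, which is the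
      convexity inequality reversed.\<close>
    have "tangent p v = p"
      using v short_fun_tangent[OF p(2)] convex_fun_tangent[OF p(2,1)] tangent_le[OF p(2,1)]
      by (intro min) (auto simp: admissible_def)
    then have "p u \<le> diffquot p v u t" using tangent_le_diffquot[OF p(2) t] by metis
    then show "t * p u + (1 - t) * p v \<le> p (m t u v)"
      using t by (simp add: diffquot_def field_simps)
  qed (use convex_funD[OF p(1) t] in simp)
  have tx: "tangent p x x = D" using tangent_self[OF p(2)] p(3) by simp
  have "tangent p v x = D" for v
  proof -
    have "diffquot p v x s = D" if "s \<in> {0<..<1}" for s
    proof -
      \<comment> \<open>Up to commuting, \<open>m s x v\<close> is on a segment with second end
        \<open>x\<close>, where \<open>aff\<close> applies; so all quotients at \<open>x\<close>
        equal \<open>D\<close>.\<close>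
      have "p (m s x v) = (1 - s) * p v + s * D"
        using aff[OF tx, of "1 - s" v] m_commute[of s x v] p(3) that by simp
      then show ?thesis using that by (simp add: diffquot_def)
    qed
    then show ?thesis by (simp add: tangent_def)
  qed
  then show ?thesis using aff by (simp add: affine_fun_def)
qed

text \<open>A minimal \<open>p\<close> below \<open>dist _ y\<close> has \<open>p y \<le> 0\<close>
  and \<open>p x = dist x y\<close>, so its increment is at least the distance; shortness gives the
  other inequality.\<close>

lemma norming_affine_fun:
  obtains f where "affine_fun f" "short_fun f" "f x - f y = dist x y"
proof -
  have "(\<lambda>u. dist u y) \<in> admissible x (dist x y)"
    by (simp add: admissible_def convex_fun_dist short_fun_dist)
  then obtain p where p: "p \<in> admissible x (dist x y)" "p \<le> (\<lambda>u. dist u y)"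
    "\<And>q. q \<in> admissible x (dist x y) \<Longrightarrow> q \<le> p \<Longrightarrow> q = p"
    using minimal_admissible by blast
  have sh: "short_fun p" and px: "p x = dist x y" using p(1) by (auto simp: admissible_def)
  have "p y \<le> 0" using p(2) by (metis dist_self le_funD)
  then have "p x - p y = dist x y" using short_funD[OF sh, of x y] px by linarith
  then show ?thesis using that minimal_admissible_affine[OF p(1,3)] sh by blast
qed

section \<open>The isometric affine embedding\<close>

definition base :: 'a where "base = (SOME x. True)"

text \<open>Evaluation at \<open>x\<close>, normalised at \<open>base\<close>: for short functions
  the difference is bounded by \<open>dist x base\<close>. On a discrete space all functions are
  continuous, so this type consists of all bounded functions. The value 0 elsewhere does not affect
  norms of differences.\<close>

definition emb :: "'a \<Rightarrow> ('a \<Rightarrow> real) discrete \<Rightarrow>\<^sub>C real" where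
  "emb x = Bcontfun (\<lambda>f. if affine_fun (of_discrete f) \<and> short_fun (of_discrete f)
     then of_discrete f x - of_discrete f base else 0)"

lemma apply_emb:
  "apply_bcontfun (emb x) f = (if affine_fun (of_discrete f) \<and> short_fun (of_discrete f)
     then of_discrete f x - of_discrete f base else 0)"
proof -
  let ?g = "\<lambda>f. if affine_fun (of_discrete f) \<and> short_fun (of_discrete f)
     then of_discrete f x - of_discrete f base else 0"
  have "?g \<in> bcontfun"
  proof (rule bcontfun_normI)
    show "continuous_on UNIV ?g"
      by (simp add: continuous_on_open_vimage open_discrete)
    show "norm (?g f) \<le> dist x base" for f
      using short_funD[of "of_discrete f" x base] short_funD[of "of_discrete f" base x]
      by (auto simp: dist_commute)
  qed
  then show ?thesis by (simp add: emb_def Bcontfun_inverse)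
qed

lemma emb_affine:
  assumes "0 < t" "t < 1" shows "emb (m t x y) = t *\<^sub>R emb x + (1 - t) *\<^sub>R emb y"
  by (rule bcontfun_eqI) (use assms in \<open>auto simp: apply_emb affine_funD algebra_simps\<close>)

text \<open>The upper bound is shortness of the functions evaluated; the function from
  \<open>norming_affine_fun\<close> attains it.\<close>

lemma dist_emb: "dist (emb x) (emb y) = dist x y"
proof (rule antisym)
  have "norm (emb x - emb y) \<le> dist x y"
  proof (rule norm_bound)
    show "norm (apply_bcontfun (emb x - emb y) f) \<le> dist x y" for f
      using short_funD[of "of_discrete f" x y] short_funD[of "of_discrete f" y x]
      by (auto simp: apply_emb dist_commute)
  qed
  then show "dist (emb x) (emb y) \<le> dist x y" by (simp add: dist_norm)
  obtain f where f: "affine_fun f" "short_fun f" "f x - f y = dist x y"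
    by (rule norming_affine_fun)
  show "dist x y \<le> dist (emb x) (emb y)"
    using f dist_bounded[of "emb x" "discrete f" "emb y"]
    by (simp add: apply_emb discrete_inverse dist_real_def)
qed

end

section \<open>Convex combinations of two points\<close>

lemma permute_to_mset_eq:
  assumes "mset xs = mset ys"
  obtains \<sigma> where "\<sigma> permutes {..<length xs}" "permute_list \<sigma> xs = ys"
  using mset_eq_permutation[OF assms[symmetric]] assms by (metis mset_eq_length)

definition rescale :: "real \<Rightarrow> (real \<times> 'a) list \<Rightarrow> (real \<times> 'a) list" where
  "rescale r = map (\<lambda>(a, u). (a / r, u))"

lemma rescale_simps [simp]:
  "rescale r [] = []" "rescale r ((a, u) # xs) = (a / r, u) # rescale r xs"
  "rescale r (xs @ ys) = rescale r xs @ rescale r ys"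
  by (simp_all add: rescale_def)

abbreviation weight :: "(real \<times> 'a) list \<Rightarrow> real" where
  "weight xs \<equiv> sum_list (map fst xs)"

lemma weight_rescale [simp]: "weight (rescale r xs) = weight xs / r"
  by (induction xs) (auto simp: add_divide_distrib)

lemma rescale_rescale: "r \<noteq> 0 \<Longrightarrow> rescale (s / r) (rescale r xs) = rescale s xs"
  by (induction xs) auto

lemma set_rescale_pos: "0 < r \<Longrightarrow> \<forall>p\<in>set xs. 0 < fst p \<Longrightarrow> \<forall>p\<in>set (rescale r xs). 0 < fst p"
  by (auto simp: rescale_def)

lemma weight_pos: "xs \<noteq> [] \<Longrightarrow> \<forall>p\<in>set xs. 0 < fst p \<Longrightarrow> 0 < weight xs"
proof (induction xs)
  case (Cons a xs) then show ?case by (cases "xs = []") auto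
qed simp

context CC_space
begin

lemma cc_mset:
  assumes "convex_weights xs" "mset xs = mset ys" shows "cc xs = cc ys"
  using permute_to_mset_eq[OF assms(2)] cc_perm[OF assms(1)] by metis

text \<open>Group the tail \<open>zs\<close>, merge it with the head by \<open>cc_assoc\<close>,
  then expand the tail again inside the inner combination. The induction is on length because the
  inner tail is rescaled.\<close>

lemma cc_group:
  assumes "convex_weights (ys @ xs)" "xs \<noteq> []"
  shows "cc (ys @ xs) = cc (ys @ [(weight xs, cc (rescale (weight xs) xs))])"
  using assms
proof (induction xs arbitrary: ys rule: length_induct)
  case (1 xs)
  obtain a u zs where xs: "xs = (a, u) # zs" using 1(3) by (metis list.exhaust prod.exhaust)
  have pos: "0 < a" "\<forall>p\<in>set zs. 0 < fst p" "\<forall>p\<in>set ys. 0 < fst p"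
    and sum: "weight ys + a + weight zs = 1"
    using 1(2) by (auto simp: convex_weights_def xs)
  show ?case
  proof (cases "zs = []")
    case True
    then show ?thesis using pos by (simp add: xs cc_single)
  next
    case False
    define W where "W = weight zs"
    have W: "0 < W" unfolding W_def using False pos by (simp add: weight_pos)
    have "cc (ys @ xs) = cc ((ys @ [(a, u)]) @ zs)" by (simp add: xs)
    also have "\<dots> = cc ((ys @ [(a, u)]) @ [(W, cc (rescale W zs))])"
      using 1(1)[rule_format, of zs "ys @ [(a, u)]"] 1(2) False by (simp add: xs W_def)
    also have "\<dots> = cc (ys @ [(a + W,
        cc [(a / (a + W), u), (W / (a + W), cc (rescale W zs))])])"
      using cc_assoc[of ys a u W "cc (rescale W zs)"] pos sum W
      by (simp add: convex_weights_def W_def[symmetric] add.assoc)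
    \<comment> \<open>The induction hypothesis for the rescaled tail, read from right to
      left.\<close>
    also have "cc [(a / (a + W), u), (W / (a + W), cc (rescale W zs))]
        = cc ([(a / (a + W), u)] @ rescale (a + W) zs)"
    proof -
      have "convex_weights ([(a / (a + W), u)] @ rescale (a + W) zs)"
        using pos W set_rescale_pos[of "a + W" zs]
        by (auto simp: convex_weights_def W_def[symmetric] add_divide_distrib[symmetric])
      moreover have "rescale (a + W) zs \<noteq> []" using False by (simp add: rescale_def)
      moreover have "rescale (W / (a + W)) (rescale (a + W) zs) = rescale W zs"
        using rescale_rescale[of "a + W" W zs] W pos by simp
      moreover have "length (rescale (a + W) zs) < length xs" by (simp add: xs rescale_def)
      ultimately show ?thesis
        using 1(1)[rule_format, of "rescale (a + W) zs" "[(a / (a + W), u)]"]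
        by (simp add: W_def[symmetric])
    qed
    finally show ?thesis by (simp add: xs W_def)
  qed
qed

text \<open>\<open>cc_group\<close> collapses only a final block, so \<open>ys\<close> is collapsed
  first, moved to the front, and then \<open>xs\<close> is collapsed.\<close>

lemma cc_group_two:
  assumes "convex_weights (xs @ ys)" "xs \<noteq> []" "ys \<noteq> []"
  shows "cc (xs @ ys) = cc [(weight xs, cc (rescale (weight xs) xs)),
                            (weight ys, cc (rescale (weight ys) ys))]"
proof -
  let ?y = "(weight ys, cc (rescale (weight ys) ys))"
  have pos: "\<forall>p\<in>set xs. 0 < fst p" "0 < weight ys" "weight xs + weight ys = 1"
    using assms by (auto simp: convex_weights_def intro!: weight_pos)
  have cw: "convex_weights (xs @ [?y])" "convex_weights ([?y] @ xs)"
    using pos by (auto simp: convex_weights_def)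
  have cw2: "convex_weights ([?y] @ [(weight xs, cc (rescale (weight xs) xs))])"
    using pos weight_pos[OF assms(2) pos(1)] by (auto simp: convex_weights_def)
  have "cc (xs @ ys) = cc (xs @ [?y])" by (rule cc_group[OF assms(1,3)])
  also have "\<dots> = cc ([?y] @ xs)" by (rule cc_mset[OF cw(1)]) simp
  also have "\<dots> = cc ([?y] @ [(weight xs, cc (rescale (weight xs) xs))])"
    by (rule cc_group[OF cw(2) assms(2)])
  also have "\<dots> = cc [(weight xs, cc (rescale (weight xs) xs)), ?y]"
    by (rule cc_mset[OF cw2]) simp
  finally show ?thesis .
qed

section \<open>The binary operation and its medial law\<close>

definition mix :: "real \<Rightarrow> 'a \<Rightarrow> 'a \<Rightarrow> 'a" where
  "mix t x y = cc [(t, x), (1 - t, y)]"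

lemma mix_commute: "0 < t \<Longrightarrow> t < 1 \<Longrightarrow> mix t x y = mix (1 - t) y x"
  unfolding mix_def by (rule cc_mset) (auto simp: convex_weights_def)

lemma mix_dist:
  "0 < t \<Longrightarrow> t < 1 \<Longrightarrow> dist (mix t u1 u2) (mix t v1 v2) \<le> t * dist u1 v1 + (1 - t) * dist u2 v2"
  unfolding mix_def by (rule cc_dist)

lemma cc_four:
  assumes "0 < a" "0 < b" "0 < c" "0 < d" "a + b + c + d = 1"
  shows "cc [(a, u), (b, v), (c, w), (d, z)]
    = mix (a + b) (mix (a / (a + b)) u v) (mix (c / (c + d)) w z)"
proof -
  have e: "1 - (a + b) = c + d" "1 - a / (a + b) = b / (a + b)" "1 - c / (c + d) = d / (c + d)"
    using assms by (auto simp: field_simps)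
  show ?thesis
    using cc_group_two[of "[(a, u), (b, v)]" "[(c, w), (d, z)]"] assms
    unfolding mix_def e by (simp add: convex_weights_def add.assoc)
qed

text \<open>Swapping the two middle entries of a four-point combination does not change it, by
  (CC.i).\<close>

lemma mix_medial:
  assumes "0 < a" "0 < b" "0 < c" "0 < d" "a + b + c + d = 1"
  shows "mix (a + b) (mix (a / (a + b)) u v) (mix (c / (c + d)) w z)
    = mix (a + c) (mix (a / (a + c)) u w) (mix (b / (b + d)) v z)"
proof -
  have "cc [(a, u), (b, v), (c, w), (d, z)] = cc [(a, u), (c, w), (b, v), (d, z)]"
    using assms by (intro cc_mset) (auto simp: convex_weights_def)
  then show ?thesis using assms by (simp add: cc_four)
qed

section \<open>Idempotence of mixing at convexified points\<close>

lemma tendsto_mix: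
  assumes "0 < t" "t < 1" "X \<longlonglongrightarrow> x" "Y \<longlonglongrightarrow> y"
  shows "(\<lambda>n. mix t (X n) (Y n)) \<longlonglongrightarrow> mix t x y"
proof (rule metric_tendsto_imp_tendsto)
  show "(\<lambda>n. t * dist (X n) x + (1 - t) * dist (Y n) y) \<longlonglongrightarrow> 0"
    using assms(3,4)[THEN tendsto_dist_iff[THEN iffD1]] by (auto intro!: tendsto_add_zero tendsto_mult_right_zero)
  show "\<forall>\<^sub>F n in sequentially. dist (mix t (X n) (Y n)) (mix t x y)
      \<le> dist (t * dist (X n) x + (1 - t) * dist (Y n) y) 0"
    using mix_dist[OF assms(1,2)] assms(1,2) by (intro always_eventually allI) simp
qed

text \<open>The \<open>a + b\<close> equal entries are grouped into blocks of \<open>a\<close> and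
  \<open>b\<close>; each block, rescaled, is again uniform.\<close>

lemma uniform_comb_add:
  assumes "0 < a" "0 < b"
  shows "uniform_comb cc v (a + b)
    = mix (real a / real (a + b)) (uniform_comb cc v a) (uniform_comb cc v b)"
proof -
  let ?r = "\<lambda>k. replicate k (1 / real (a + b), v)"
  have w: "weight (?r k) = real k / real (a + b)" for k by (simp add: sum_list_replicate)
  have s: "rescale (real k / real (a + b)) (?r k) = replicate k (1 / real k, v)" if "0 < k" for k
    using that assms by (auto simp: rescale_def)
  have e: "1 - real a / real (a + b) = real b / real (a + b)" using assms by (simp add: field_simps)
  have "convex_weights (?r a @ ?r b)"
    using assms by (auto simp: convex_weights_def sum_list_replicate add_divide_distrib[symmetric])
  then have "cc (?r a @ ?r b) = cc [(real a / real (a + b), cc (replicate a (1 / real a, v))),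
      (real b / real (a + b), cc (replicate b (1 / real b, v)))]"
    using cc_group_two[of "?r a" "?r b"] assms unfolding w s[OF assms(1)] s[OF assms(2)] by simp
  then show ?thesis unfolding mix_def uniform_comb_def e by (simp add: replicate_add)
qed

text \<open>Along the multiples of \<open>a\<close>, \<open>b\<close> and \<open>a + b\<close> the
  ratio in \<open>uniform_comb_add\<close> stays constant, and all three subsequences tend to
  \<open>k\<close>.\<close>

lemma mix_convexification_rat:
  fixes v
  assumes "0 < a" "0 < b"
  defines "k \<equiv> convexification cc v"
  shows "mix (real a / real (a + b)) k k = k"
proof -
  have lim: "uniform_comb cc v \<longlonglongrightarrow> k"
    unfolding k_def convexification_def using cc_convergent by (simp add: convergent_LIMSEQ_iff)
  \<comment> \<open>\<open>Suc n\<close> avoids the meaningless index 0.\<close>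
  have sub: "(\<lambda>n. uniform_comb cc v (c * Suc n)) \<longlonglongrightarrow> k" if "0 < c" for c
    using LIMSEQ_subseq_LIMSEQ[OF lim, of "\<lambda>n. c * Suc n"] that
    by (simp add: strict_mono_def o_def)
  have t: "0 < real a / real (a + b)" "real a / real (a + b) < 1" using assms by auto
  have r: "real (a * Suc n) / real ((a + b) * Suc n) = real a / real (a + b)" for n
    unfolding of_nat_mult by (rule mult_divide_mult_cancel_right) simp
  have "uniform_comb cc v ((a + b) * Suc n) = mix (real a / real (a + b))
      (uniform_comb cc v (a * Suc n)) (uniform_comb cc v (b * Suc n))" for n
    using uniform_comb_add[of "a * Suc n" "b * Suc n" v] assms(1,2)
    by (simp only: distrib_right[symmetric] r) simp
  then have "(\<lambda>n. uniform_comb cc v ((a + b) * Suc n)) \<longlonglongrightarrow> mix (real a / real (a + b)) k k"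
    using tendsto_mix[OF t sub[OF assms(1)] sub[OF assms(2)]] by simp
  then show ?thesis using sub[of "a + b"] assms(1) LIMSEQ_unique by (metis add_gr_0)
qed

text \<open>Rational weights are dense, and (CC.iii) passes to the limit in the weight.\<close>

lemma mix_convexification:
  fixes v
  assumes t: "0 < t" "t < 1"
  defines "k \<equiv> convexification cc v"
  shows "mix t k k = k"
proof -
  have rat: "mix r k k = k" if "r \<in> \<rat>" "0 < r" "r < 1" for r
  proof -
    obtain a b :: nat where ab: "b \<noteq> 0" "\<bar>r\<bar> = real a / real b" 
      using Rats_abs_nat_div_natE[OF \<open>r \<in> \<rat>\<close>] by metis
    then have "0 < a" "a < b" using that 
      using mult_strict_right_mono[of r 1 "real b"] by (auto simp: field_simps intro: gr0I)
    then show ?thesis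
      using mix_convexification_rat[of a "b - a" v] ab that unfolding k_def by simp
  qed
  \<comment> \<open>The approximations are kept strictly between 0 and 1, as \<open>cc_cont\<close>
    demands.\<close>
  have "\<exists>r\<in>\<rat>. r \<in> {0<..<1} \<and> dist r t < 1 / Suc n" for n
  proof -
    have "0 < 1 / real (Suc n)" by simp
    then have "max 0 (t - 1 / Suc n) < min 1 (t + 1 / Suc n)" using t by linarith
    then obtain r where "r \<in> \<rat>" "max 0 (t - 1 / Suc n) < r" "r < min 1 (t + 1 / Suc n)"
      using Rats_dense_in_real by blast
    then show ?thesis by (intro bexI[of _ r]) (auto simp: dist_real_def)
  qed
  then obtain l where l: "\<And>n. l n \<in> \<rat>" "\<And>n. 0 < l n \<and> l n < 1" "\<And>n. dist (l n) t < 1 / Suc n"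
    by (metis greaterThanLessThan_iff)
  have "l \<longlonglongrightarrow> t"
    using l(3) by (intro metric_tendsto_imp_tendsto[OF LIMSEQ_inverse_real_of_nat])
      (auto simp: inverse_eq_divide less_imp_le)
  then have "(\<lambda>n. mix (l n) k k) \<longlonglongrightarrow> mix t k k"
    unfolding mix_def using l(2) t by (intro cc_cont) auto
  moreover have "mix (l n) k k = k" for n using rat l by auto
  ultimately show ?thesis by (simp add: LIMSEQ_const_iff)
qed

end

section \<open>Banach spaces carried by another type\<close>

text \<open>The embedding takes values in a type of bounded functions, while the carrier sought lies
  in a type of plain functions; the injection \<open>h\<close> carries the structure across.\<close>

locale transported_subspace =
  fixes S :: "'v::{real_normed_vector,complete_space} set" and h :: "'v \<Rightarrow> 'e"
  assumes subspace: "subspace S" and closed: "closed S" and inj: "inj h"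
begin

definition tadd :: "'e \<Rightarrow> 'e \<Rightarrow> 'e" where "tadd a b = h (inv h a + inv h b)"
definition tscale :: "real \<Rightarrow> 'e \<Rightarrow> 'e" where "tscale r a = h (r *\<^sub>R inv h a)"
definition tnorm :: "'e \<Rightarrow> real" where "tnorm a = norm (inv h a)"

lemma inv_h [simp]: "inv h (h a) = a"
  by (rule inv_f_f[OF inj])

lemma h_eq [simp]: "h a = h b \<longleftrightarrow> a = b"
  using inj by (simp add: inj_eq)

lemma h_mem_iff [simp]: "h a \<in> h ` S \<longleftrightarrow> a \<in> S"
  using inj by (simp add: inj_image_mem_iff)

lemma tadd_h [simp]: "tadd (h a) (h b) = h (a + b)"
  and tscale_h [simp]: "tscale r (h a) = h (r *\<^sub>R a)"
  and tnorm_h [simp]: "tnorm (h a) = norm a"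
  by (simp_all add: tadd_def tscale_def tnorm_def)

sublocale N: normed_space_on "h ` S" tadd "h 0" tscale tnorm
proof
  show "\<exists>y\<in>h ` S. tadd x y = h 0" if x: "x \<in> h ` S" for x
  proof -
    obtain a where "x = h a" "a \<in> S" using x by blast
    then show ?thesis using subspace by (intro bexI[of _ "h (- a)"]) (auto simp: subspace_neg)
  qed
qed (use subspace in \<open>auto simp: subspace_0 subspace_add subspace_scale add.assoc add.commute
    algebra_simps norm_triangle_ineq\<close>)

lemma sub_h [simp]: "N.sub (h a) (h b) = h (a - b)"
  by (simp add: N.sub_def)

lemma ndist_h: "a \<in> S \<Longrightarrow> b \<in> S \<Longrightarrow> N.ndist (h a) (h b) = dist a b"
  by (simp add: N.ndist_def dist_norm)

lemma limitin_h:
  assumes "\<And>n. X n \<in> S" "x \<in> S"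
  shows "limitin N.mtopology (\<lambda>n. h (X n)) (h x) sequentially \<longleftrightarrow> X \<longlonglongrightarrow> x"
  using assms by (simp add: N.limit_metric_sequentially ndist_h lim_sequentially)

text \<open>A Cauchy sequence is pulled back along \<open>h\<close> and converges in the complete
  ambient space; its limit stays in the closed set \<open>S\<close>.\<close>

sublocale banach_space_on "h ` S" tadd "h 0" tscale tnorm
proof
  show "N.mcomplete" unfolding N.mcomplete_def
  proof (intro allI impI)
    fix \<sigma> assume \<sigma>: "N.MCauchy \<sigma>"
    define X where "X = (\<lambda>n. inv h (\<sigma> n))"
    have "\<sigma> n \<in> h ` S" for n using \<sigma> by (auto simp: N.MCauchy_def)
    then have X: "\<sigma> n = h (X n)" "X n \<in> S" for n unfolding X_def by (metis imageE inv_h)+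
    have "Cauchy X" using \<sigma> by (simp add: N.MCauchy_def Cauchy_def X ndist_h)
    then obtain x where "X \<longlonglongrightarrow> x" using Cauchy_convergent convergent_def by blast
    moreover from this have "x \<in> S" using closed X(2) closed_sequentially by blast
    moreover have "\<sigma> = (\<lambda>n. h (X n))" using X by auto
    ultimately show "\<exists>x. limitin N.mtopology \<sigma> x sequentially" using limitin_h[of X x] X(2) by blast
  qed
qed

lemma closedin_image:
  assumes "C \<subseteq> S" "closed C" shows "closedin N.mtopology (h ` C)"
  unfolding N.metric_closedin_iff_sequentially_closed
proof (intro conjI allI impI)
  show "h ` C \<subseteq> h ` S" using assms by auto
  fix \<sigma> l assume a: "range \<sigma> \<subseteq> h ` C \<and> limitin N.mtopology \<sigma> l sequentially"
  define X where "X = (\<lambda>n. inv h (\<sigma> n))"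
  have "\<sigma> n \<in> h ` C" for n using a by auto
  then have X: "\<sigma> n = h (X n)" "X n \<in> C" for n unfolding X_def by (metis imageE inv_h)+
  have "l \<in> h ` S" using a N.limitin_mspace by blast
  then obtain x where x: "l = h x" "x \<in> S" by auto
  have "\<sigma> = (\<lambda>n. h (X n))" using X by auto
  then have "X \<longlonglongrightarrow> x" using limitin_h[of X x] X x a assms by auto
  then show "l \<in> h ` C" using closed_sequentially[OF assms(2)] X x by auto
qed

lemma separable_image:
  assumes "countable Q" "Q \<subseteq> S" "S \<subseteq> closure Q"
  shows "separable_space N.mtopology"
  unfolding separable_space_def
proof (intro exI conjI)
  show "countable (h ` Q)" "h ` Q \<subseteq> topspace N.mtopology" using assms by auto
  have "\<exists>y\<in>h ` Q. y \<in> N.mball (h a) r" if "a \<in> S" "0 < r" for a r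
  proof -
    have "a \<in> closure Q" using that assms by auto
    then obtain q where "q \<in> Q" "dist q a < r" using \<open>0 < r\<close> by (auto simp: closure_approachable)
    then show ?thesis
      using that assms(2) by (intro bexI[of _ "h q"]) (auto simp: ndist_h dist_commute)
  qed
  then show "N.mtopology closure_of (h ` Q) = topspace N.mtopology"
    by (auto simp: N.metric_closure_of)
qed

lemma convex_in_image: "convex C \<Longrightarrow> C \<subseteq> S \<Longrightarrow> N.convex_in (h ` C)"
  unfolding N.convex_in_def by (auto simp: convex_alt algebra_simps)

end

section \<open>Rational linear combinations\<close>

inductive_set rational_span :: "'v::real_vector set \<Rightarrow> 'v set" for B where
  rational_span_zero: "0 \<in> rational_span B"
| rational_span_step: "b \<in> B \<Longrightarrow> v \<in> rational_span B \<Longrightarrow> of_rat q *\<^sub>R b + v \<in> rational_span B"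

text \<open>Coding combinations by finite lists yields countability.\<close>

lemma rational_span_altdef:
  "rational_span B = (\<lambda>xs. \<Sum>(q, b)\<leftarrow>xs. real_of_rat q *\<^sub>R b) ` lists (UNIV \<times> B)"
proof (intro equalityI subsetI)
  fix v assume "v \<in> rational_span B"
  then show "v \<in> (\<lambda>xs. \<Sum>(q, b)\<leftarrow>xs. real_of_rat q *\<^sub>R b) ` lists (UNIV \<times> B)"
  proof induction
    case rational_span_zero
    then show ?case by (intro image_eqI[of _ _ "[]"]) auto
  next
    case (rational_span_step b v q)
    then obtain xs where "v = (\<Sum>(q, b)\<leftarrow>xs. real_of_rat q *\<^sub>R b)" "xs \<in> lists (UNIV \<times> B)" by auto
    then show ?case using rational_span_step by (intro image_eqI[of _ _ "(q, b) # xs"]) auto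
  qed
next
  fix v assume "v \<in> (\<lambda>xs. \<Sum>(q, b)\<leftarrow>xs. real_of_rat q *\<^sub>R b) ` lists (UNIV \<times> B)"
  then obtain xs where v: "v = (\<Sum>(q, b)\<leftarrow>xs. real_of_rat q *\<^sub>R b)" and "xs \<in> lists (UNIV \<times> B)" by auto
  from this(2) show "v \<in> rational_span B" unfolding v
    by induction (auto intro: rational_span.intros)
qed

lemma countable_rational_span: "countable B \<Longrightarrow> countable (rational_span B)"
  unfolding rational_span_altdef by (intro countable_image countable_lists) auto

lemma rational_span_add: "v \<in> rational_span B \<Longrightarrow> w \<in> rational_span B \<Longrightarrow> v + w \<in> rational_span B"
  by (induction rule: rational_span.induct) (auto simp: add.assoc intro: rational_span.intros)

lemma rational_span_scale: "v \<in> rational_span B \<Longrightarrow> of_rat q *\<^sub>R v \<in> rational_span B"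
  by (induction rule: rational_span.induct)
    (auto simp: scaleR_add_right simp flip: of_rat_mult intro: rational_span.intros)

lemma rational_span_superset: "B \<subseteq> rational_span B"
  using rational_span_step[OF _ rational_span_zero, of _ _ 1] by auto

lemma rational_span_subset: "subspace S \<Longrightarrow> B \<subseteq> S \<Longrightarrow> rational_span B \<subseteq> S"
proof
  fix v assume "subspace S" "B \<subseteq> S" "v \<in> rational_span B"
  from this(3) this(1,2) show "v \<in> S"
    by induction (auto intro!: subspace_0 subspace_add subspace_scale)
qed

text \<open>A real scalar is approximated by rationals at the same time as the vector by
  combinations. Thus the closed linear span has a dense subset that is countable whenever
  \<open>B\<close> is.\<close>

lemma subspace_closure_rational_span:
  fixes B :: "'v::real_normed_vector set"
  shows "subspace (closure (rational_span B))"
  unfolding subspace_def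
proof (intro conjI ballI allI)
  let ?Q = "rational_span B"
  show "0 \<in> closure ?Q" using rational_span_zero closure_subset by blast
  show "v + w \<in> closure ?Q" if vw: "v \<in> closure ?Q" "w \<in> closure ?Q" for v w
  proof -
    obtain X Y where X: "\<And>n. X n \<in> ?Q" "X \<longlonglongrightarrow> v" and Y: "\<And>n. Y n \<in> ?Q" "Y \<longlonglongrightarrow> w"
      using vw unfolding closure_sequential by blast
    then show ?thesis
      unfolding closure_sequential
      by (intro exI[of _ "\<lambda>n. X n + Y n"]) (auto intro: rational_span_add tendsto_add)
  qed
  show "c *\<^sub>R v \<in> closure ?Q" if v: "v \<in> closure ?Q" for c v
  proof -
    obtain X where X: "\<And>n. X n \<in> ?Q" "X \<longlonglongrightarrow> v"
      using v unfolding closure_sequential by blast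
    have "c \<in> closure \<rat>" by (simp add: Rats_closure_real)
    then obtain r where r: "\<And>n. r n \<in> \<rat>" "r \<longlonglongrightarrow> c" unfolding closure_sequential by blast
    have "r n *\<^sub>R X n \<in> ?Q" for n
      using r(1)[of n] rational_span_scale[OF X(1)] by (auto elim: Rats_cases)
    then show ?thesis
      unfolding closure_sequential using r X
      by (intro exI[of _ "\<lambda>n. r n *\<^sub>R X n"]) (auto intro: tendsto_scaleR)
  qed
qed

section \<open>The embedding theorem\<close>

text \<open>Convexifiability enters here: every point is some \<open>convexification cc v\<close>,
  where mixing is idempotent.\<close>

lemma (in CC_space) convex_metric_mix:
  assumes "convexifiable cc" shows "convex_metric mix"
proof
  show "mix t x x = x" if "0 < t" "t < 1" for t x
  proof -
    obtain v where "x = convexification cc v" using assms by (auto simp: convexifiable_def)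
    then show ?thesis using mix_convexification[OF that] by simp
  qed
qed (fact mix_commute mix_medial mix_dist)+

lemma (in CC_space) cc_ext_two:
  "cc_ext cc [(t, x), (1 - t, y)] = (if t = 0 then y else if t = 1 then x else mix t x y)"
  by (simp add: cc_ext_def mix_def cc_single)

theorem theorem3p3:
  fixes cc :: "(real \<times> 'a::complete_space) list \<Rightarrow> 'a"
  assumes "CC_space cc" and "convexifiable cc"
  shows "\<exists>(E :: (('a \<Rightarrow> real) \<Rightarrow> real) set) add zero scale nrm (j :: 'a \<Rightarrow> ('a \<Rightarrow> real) \<Rightarrow> real).
    banach_space_on E add zero scale nrm \<and>
    range j \<subseteq> E \<and>
    closedin (Metric_space.mtopology E (normed_space_on.ndist E add scale nrm)) (range j) \<and>
    normed_space_on.convex_in E add scale (range j) \<and>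
    (\<forall>x y. \<forall>t\<in>{0..1}.
       j (cc_ext cc [(t, x), (1 - t, y)]) = add (scale t (j x)) (scale (1 - t) (j y))) \<and>
    (\<forall>x y. dist x y = nrm (normed_space_on.sub add scale (j x) (j y))) \<and>
    (separable_space (euclidean :: 'a topology) \<longrightarrow>
     separable_space (Metric_space.mtopology E (normed_space_on.ndist E add scale nrm)))"
proof -
  interpret CC_space cc by fact
  interpret M: convex_metric mix by (rule convex_metric_mix) fact
  define B where "B = range M.emb"
  define S where "S = closure (rational_span B)"
  \<comment> \<open>\<open>h\<close> only forgets boundedness and the discrete topology.\<close>
  define h :: "(('a \<Rightarrow> real) discrete \<Rightarrow>\<^sub>C real) \<Rightarrow> ('a \<Rightarrow> real) \<Rightarrow> real"
    where "h g = (\<lambda>f. apply_bcontfun g (discrete f))" for g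
  have "inj h"
  proof (rule injI, rule bcontfun_eqI)
    fix g k f assume "h g = h k"
    then have "h g (of_discrete f) = h k (of_discrete f)" by simp
    then show "apply_bcontfun g f = apply_bcontfun k f" by (simp add: h_def of_discrete_inverse)
  qed
  then interpret T: transported_subspace S h
    by unfold_locales (auto simp: S_def subspace_closure_rational_span)
  have BS: "B \<subseteq> S" unfolding S_def using rational_span_superset closure_subset by (rule subset_trans)
  have emb: "M.emb (cc_ext cc [(t, x), (1 - t, y)]) = t *\<^sub>R M.emb x + (1 - t) *\<^sub>R M.emb y"
    if "t \<in> {0..1}" for x y t
    using that M.emb_affine[of t x y] by (auto simp: cc_ext_two)
  have "convex B" unfolding convex_alt B_def
  proof safe
    fix x y and t :: real assume "0 \<le> t" "t \<le> 1"
    then show "(1 - t) *\<^sub>R M.emb x + t *\<^sub>R M.emb y \<in> range M.emb"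
      using emb[of "1 - t" x y] by (intro range_eqI[OF sym]) simp
  qed
  \<comment> \<open>Completeness of the original space is transferred by the isometry.\<close>
  have "complete B" unfolding B_def
  proof (rule completeI)
    fix X assume X: "\<forall>n. X n \<in> range M.emb" "Cauchy X"
    have "\<forall>n. \<exists>y. X n = M.emb y" using X(1) by blast
    then obtain x where x: "X n = M.emb (x n)" for n using choice[of "\<lambda>n y. X n = M.emb y"] by blast
    then have "Cauchy x" using X(2) by (simp add: Cauchy_def M.dist_emb)
    then obtain l where "x \<longlonglongrightarrow> l" using Cauchy_convergent convergent_def by blast
    then have "X \<longlonglongrightarrow> M.emb l" by (simp add: lim_sequentially x M.dist_emb)
    then show "\<exists>l\<in>range M.emb. X \<longlonglongrightarrow> l" by blast
  qed
  then have "closed B" by (rule complete_imp_closed)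
  have sep: "separable_space T.N.mtopology" if X: "separable_space (euclidean :: 'a topology)"
  proof -
    obtain D :: "'a set" where D: "countable D" "closure D = UNIV"
      using X by (auto simp: separable_space_def)
    \<comment> \<open>Rational combinations of the image of a countable dense set form the countable
      dense subset of \<open>S\<close>.\<close>
    let ?Q = "rational_span (M.emb ` D)"
    have QS: "?Q \<subseteq> S"
      using BS T.subspace by (intro rational_span_subset) (auto simp: B_def)
    have "continuous_on UNIV M.emb"
      by (rule continuous_on_iff[THEN iffD2]) (auto simp: M.dist_emb)
    then have "M.emb ` closure D \<subseteq> closure (M.emb ` D)"
      by (intro continuous_image_closure_subset) auto
    also have "\<dots> \<subseteq> closure ?Q" by (intro closure_mono rational_span_superset)
    finally have "B \<subseteq> closure ?Q" using D by (simp add: B_def)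
    \<comment> \<open>The closure of \<open>?Q\<close> is a subspace, so it contains all
      combinations of \<open>B\<close> once it contains \<open>B\<close>.\<close>
    then have "rational_span B \<subseteq> closure ?Q"
      by (rule rational_span_subset[OF subspace_closure_rational_span])
    then have "S \<subseteq> closure ?Q" unfolding S_def by (rule closure_minimal) simp
    then show ?thesis
      by (intro T.separable_image[OF countable_rational_span QS] countable_image D(1))
  qed
  have range: "range (\<lambda>x. h (M.emb x)) = h ` B" by (auto simp: B_def)
  show ?thesis
  proof (intro exI[of _ "h ` S"] exI[of _ T.tadd] exI[of _ "h 0"] exI[of _ T.tscale]
      exI[of _ T.tnorm] exI[of _ "\<lambda>x. h (M.emb x)"] conjI impI allI ballI)
    show "banach_space_on (h ` S) T.tadd (h 0) T.tscale T.tnorm" by unfold_locales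
    show "range (\<lambda>x. h (M.emb x)) \<subseteq> h ` S" using BS unfolding range by blast
    show "closedin T.N.mtopology (range (\<lambda>x. h (M.emb x)))"
      unfolding range using BS \<open>closed B\<close> by (rule T.closedin_image)
    show "T.N.convex_in (range (\<lambda>x. h (M.emb x)))"
      unfolding range using \<open>convex B\<close> BS by (rule T.convex_in_image)
    show "separable_space T.N.mtopology" if "separable_space (euclidean :: 'a topology)"
      using that by (rule sep)
  qed (simp_all add: emb M.dist_emb flip: dist_norm)
qed

end
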